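(* Let $\mathsf{Z}=[-1/2,1/2]$, let $\mu$ be the uniform probability measure on $\mathsf{Z}$, and let $u:\mathbb{R}\times\mathsf{Z}\to\mathbb{R}$ be given by $$u(x,z)=\begin{cases}(x+\pi)^4/(1+(x+\pi)^2)+\cos(3x)+zx,& x<-\pi,\\ \cos(3x)+zx,&-\pi\le x\le\pi,\\ (x-\pi)^4/(1+(x-\pi)^2)+\cos(3x)+zx,&x>\pi.\end{cases}$$ Then $\mu^{\otimes n}S_0$ converges weakly to $(\delta_{-\pi}+\delta_{\pi})/2$ as $n\to+\infty$, and for every integer $n\ge1$ $$\mu^{\otimes n}S_0[U]-U^\star\le\frac{\pi}{6\sqrt3}\,n^{-1/2}.$$
   Context: $U(x)=\int_{\mathsf{Z}}u(x,z)\,d\mu(z)$ and $U^\star=\min_{\mathbb{R}}U$. For $z^{1:n}=(z_1,\dots,z_n)\in\mathsf{Z}^n$, $U_n(x,z^{1:n})=\frac1n\sum_{i=1}^nu(x,z_i)$ and $\mathsf{C}(z^{1:n})=\operatorname{argmin}_{x\in\mathbb{R}}U_n(x,z^{1:n})$. $S_0(z^{1:n},\cdot)$ is the probability measure on $\mathbb{R}$ defined by $S_0(z^{1:n},\mathsf{A})=\sum_{x\in\mathsf{C}(z^{1:n})\cap\mathsf{A}}(\partial_x^2U_n(x,z^{1:n}))^{-1/2}\big/\sum_{x\in\mathsf{C}(z^{1:n})}(\partial_x^2U_n(x,z^{1:n}))^{-1/2}$. The probability measure $\mu^{\otimes n}S_0$ on $\mathbb{R}$ is $\mu^{\otimes n}S_0(\mathsf{A})=\int_{\mathsf{Z}^n}S_0(z^{1:n},\mathsf{A})\,d\mu^{\otimes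 n}(z^{1:n})$, and $\mu^{\otimes n}S_0[U]$ is the integral of $U$ against it. $\delta_a$ is the Dirac mass at $a$. *)

theory Defs
  imports "HOL-Probability.Probability"
begin

text \<open>
  An integrand is a curried function \<open>u x z\<close> and a sample \<open>z\<^sub>1, \<dots>, z\<^sub>n\<close> is a function
  \<open>z :: nat \<Rightarrow> real\<close> read on \<open>{1..n}\<close>, so that the product space is \<open>PiM {1..n} (\<lambda>_. \<mu>)\<close>.
\<close>

definition mean_fun :: "real measure \<Rightarrow> (real \<Rightarrow> real \<Rightarrow> real) \<Rightarrow> real \<Rightarrow> real" where
  "mean_fun \<mu> u x = (\<integral>z. u x z \<partial>\<mu>)"

text \<open>
  \<open>LEAST\<close> over the range is the attained minimum, not the infimum.
\<close>

definition min_value :: "(real \<Rightarrow> real) \<Rightarrow> real" where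
  "min_value f = (LEAST v. v \<in> range f)"

definition emp_fun :: "(real \<Rightarrow> real \<Rightarrow> real) \<Rightarrow> nat \<Rightarrow> real \<Rightarrow> (nat \<Rightarrow> real) \<Rightarrow> real" where
  "emp_fun u n x z = (1 / real n) * (\<Sum>i=1..n. u x (z i))"

definition emp_argmin :: "(real \<Rightarrow> real \<Rightarrow> real) \<Rightarrow> nat \<Rightarrow> (nat \<Rightarrow> real) \<Rightarrow> real set" where
  "emp_argmin u n z = {x. is_arg_min (\<lambda>y. emp_fun u n y z) (\<lambda>_. True) x}"

definition laplace_weight :: "(real \<Rightarrow> real \<Rightarrow> real) \<Rightarrow> nat \<Rightarrow> (nat \<Rightarrow> real) \<Rightarrow> real \<Rightarrow> real" where
  "laplace_weight u n z x = (deriv (deriv (\<lambda>y. emp_fun u n y z)) x) powr (- 1 / 2)"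

text \<open>
  The next definition is meaningful when \<open>emp_argmin u n z\<close> is finite and nonempty with
  positive second derivatives there; over an infinite set the denominator is \<open>0\<close>.
\<close>

definition S0 :: "(real \<Rightarrow> real \<Rightarrow> real) \<Rightarrow> nat \<Rightarrow> (nat \<Rightarrow> real) \<Rightarrow> real measure" where
  "S0 u n z = measure_of UNIV (sets borel)
     (\<lambda>A. ennreal ((\<Sum>x\<in>emp_argmin u n z \<inter> A. laplace_weight u n z x)
                 / (\<Sum>x\<in>emp_argmin u n z. laplace_weight u n z x)))"

definition mixed_S0 :: "real measure \<Rightarrow> (real \<Rightarrow> real \<Rightarrow> real) \<Rightarrow> nat \<Rightarrow> real measure" where
  "mixed_S0 \<mu> u n = measure_of UNIV (sets borel)
     (\<lambda>A. \<integral>\<^sup>+z. emeasure (S0 u n z) A \<partial>(PiM {1..n} (\<lambda>_. \<mu>)))"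

definition dirac_average :: "real \<Rightarrow> real \<Rightarrow> real measure" where
  "dirac_average a b = measure_of UNIV (sets borel)
     (\<lambda>A. (emeasure (return borel a) A + emeasure (return borel b) A) / 2)"

definition Z :: "real set" where
  "Z = {- 1 / 2..1 / 2}"

text \<open>
  Restricting to \<open>Z\<close> makes \<open>Z\<close> itself, rather than the whole line, the underlying space.
\<close>

definition mu :: "real measure" where
  "mu = restrict_space (uniform_measure lborel Z) Z"

definition u :: "real \<Rightarrow> real \<Rightarrow> real" where
  "u x z =
     (if x < - pi then (x + pi) ^ 4 / (1 + (x + pi)\<^sup>2) + cos (3 * x) + z * x
      else if x \<le> pi then cos (3 * x) + z * x
      else (x - pi) ^ 4 / (1 + (x - pi)\<^sup>2) + cos (3 * x) + z * x)"

end

theory Submission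
  imports Defs
begin

text \<open>
  Write \<open>V x = u x 0\<close>. Since \<open>u x z = V x + z * x\<close>, the empirical mean of \<open>u\<close> depends on the sample only
  through its mean \<open>t\<close>: it is the tilted potential \<open>V x + t * x\<close>, whereas the population mean is \<open>V\<close>.
  The even function \<open>V\<close> has minimum \<open>-1\<close>, attained exactly at \<open>\<plusminus> pi\<close> and \<open>\<plusminus> pi / 3\<close>. A tilt with
  \<open>0 < \<bar>t\<bar> \<le> 1 / 2\<close>, however small, favours the outermost of these four points on one side: it moves
  the minimiser to the unique point \<open>- sgn t * (pi + s)\<close> with \<open>0 < s < pi / 6\<close>, where the second
  derivative is positive (\<open>minimizers_unique\<close>, \<open>tilt_deriv2_pos\<close>). As \<open>t \<noteq> 0\<close> almost surely,
  \<open>S0\<close> is almost surely a point mass, and \<open>\<mu>\<^sup>n S0\<close> is the law of the minimiser (\<open>mixed_S0_eq_distr\<close>).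

  The limit follows from two facts. By symmetry the sign of \<open>t\<close> is a fair coin, so each side gets mass
  \<open>1 / 2\<close>; and \<open>s ^ 3 \<le> 2 * \<bar>t\<bar>\<close> with \<open>t\<close> tending to \<open>0\<close> in probability, so the minimiser approaches \<open>\<plusminus> pi\<close>.

  For the risk, compare the minimiser \<open>x\<close> with the competitor \<open>- sgn t * pi\<close>, where \<open>V = -1\<close>. Minimality
  gives \<open>V x + 1 \<le> \<bar>t\<bar> * s \<le> (pi / 6) * \<bar>t\<bar>\<close>, and the mean of \<open>\<bar>t\<bar>\<close> is at most the standard deviation
  \<open>1 / sqrt (12 * n)\<close> of \<open>t\<close>. This is half of the asserted bound.
\<close>

section \<open>The tilted potential\<close>

definition potential :: "real \<Rightarrow> real" where
  "potential x = u x 0"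

definition tilt :: "real \<Rightarrow> real \<Rightarrow> real" where
  "tilt t x = potential x + t * x"

definition minimizers :: "real \<Rightarrow> real set" where
  "minimizers t = {x. \<forall>y. tilt t x \<le> tilt t y}"

definition penalty :: "real \<Rightarrow> real" where
  "penalty s = s ^ 4 / (1 + s\<^sup>2)"

lemma one_plus_square_pos: "0 < 1 + (s::real)\<^sup>2"
  by (simp add: add_pos_nonneg)

lemma u_eq_tilt: "u x z = tilt z x"
  by (simp add: u_def tilt_def potential_def)

lemma penalty_nonneg: "0 \<le> penalty s"
  by (simp add: penalty_def)

lemma penalty_zero [simp]: "penalty 0 = 0"
  by (simp add: penalty_def)

text \<open>
  The frequency \<open>3\<close> is odd, so \<open>cos (3 * x)\<close> is at its minimum at \<open>pi\<close>. In the outward coordinate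
  \<open>s = \<bar>x\<bar> - pi\<close> the potential becomes \<open>penalty s - cos (3 * s)\<close>, with a well at \<open>s = 0\<close>.
\<close>

lemma cos_triple_plus_pi: "cos (3 * (pi + s)) = - cos (3 * s)"
proof -
  have "cos (3 * (pi + s)) = cos (pi + 3 * s + 2 * pi)"
    by (simp add: algebra_simps)
  also have "\<dots> = cos (pi + 3 * s)"
    by (rule cos_periodic)
  also have "\<dots> = - cos (3 * s)"
    by (simp add: cos_add)
  finally show ?thesis .
qed

lemma potential_outer:
  assumes "0 \<le> s"
  shows "potential (pi + s) = penalty s - cos (3 * s)"
proof (cases "s = 0")
  case True
  then show ?thesis
    using cos_triple_plus_pi[of 0] by (simp add: potential_def u_def)
next
  case False
  with assms have "0 < s" by simp
  moreover have "\<not> pi + s < - pi" using assms pi_gt_zero by linarith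
  ultimately show ?thesis
    using cos_triple_plus_pi[of s] by (simp add: potential_def u_def penalty_def)
qed

lemma penalty_minus: "penalty (- s) = penalty s"
  by (simp add: penalty_def)

lemma potential_eq:
  "potential x = (if x < - pi then penalty (x + pi) else if x \<le> pi then 0 else penalty (x - pi)) + cos (3 * x)"
  by (simp add: potential_def u_def penalty_def)

lemma potential_even: "potential (- x) = potential x"
proof -
  have outer: "potential (- y) = potential y" if "pi < y" for y
  proof -
    have "potential (- y) = penalty (- (y - pi)) + cos (3 * y)"
      using that pi_gt_zero by (simp add: potential_eq)
    also have "\<dots> = potential y"
      unfolding penalty_minus using that pi_gt_zero less_trans[of "- pi" pi y]
      by (simp add: potential_eq)
    finally show ?thesis .
  qed
  consider "pi < x" | "pi < - x" | "- pi \<le> x" "x \<le> pi" by linarith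
  then show ?thesis
  proof cases
    case 1
    then show ?thesis by (rule outer)
  next
    case 2
    then show ?thesis using outer[of "- x"] by simp
  next
    case 3
    then show ?thesis by (simp add: potential_eq)
  qed
qed

lemma potential_ge: "- 1 \<le> potential x"
proof -
  have "- 1 \<le> cos (3 * x)" by simp
  moreover have "cos (3 * x) \<le> potential x"
    by (simp add: potential_def u_def)
  ultimately show ?thesis by linarith
qed

lemma potential_pi: "potential pi = - 1"
  using potential_outer[of 0] by simp

lemma potential_minus_pi: "potential (- pi) = - 1"
  by (simp add: potential_even potential_pi)

lemma tilt_reflect: "tilt t (- x) = tilt (- t) x"
  by (simp add: tilt_def potential_even)

text \<open>
  Reflection reduces the minimisers for a negative tilt to those for a positive one.
\<close>

lemma minimizers_reflect: "minimizers (- t) = uminus ` minimizers t"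
proof -
  have "x \<in> minimizers (- t) \<longleftrightarrow> - x \<in> minimizers t" for x
  proof -
    have "(\<forall>y. tilt (- t) x \<le> tilt (- t) y) \<longleftrightarrow> (\<forall>y. tilt (- t) x \<le> tilt (- t) (- y))"
      using minus_minus[where 'a = real] by metis
    then show ?thesis unfolding minimizers_def mem_Collect_eq by (simp add: tilt_reflect)
  qed
  moreover have "x \<in> uminus ` A \<longleftrightarrow> - x \<in> A" for x :: real and A
    using image_eqI[of x uminus "- x" A] by auto
  ultimately show ?thesis by blast
qed

lemma tilt_left:
  assumes "0 \<le> s"
  shows "tilt t (- pi - s) = penalty s - cos (3 * s) - t * s - t * pi"
  using potential_even[of "pi + s"] potential_outer[OF assms]
  by (simp add: tilt_def algebra_simps)

lemma penalty_ge_half: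
  assumes "1 < s"
  shows "s / 2 < penalty s"
proof -
  have "s\<^sup>2 < s ^ 3" using assms by (intro power_strict_increasing) auto
  moreover have "1 < s ^ 3" using assms by (simp add: one_less_power)
  ultimately have "1 + s\<^sup>2 < 2 * s ^ 3" by linarith
  then have "s * (1 + s\<^sup>2) < s * (2 * s ^ 3)"
    using assms by (intro mult_strict_left_mono) auto
  moreover have "s * (2 * s ^ 3) = 2 * s ^ 4"
    by (simp add: power4_eq_xxxx power3_eq_cube)
  ultimately show ?thesis
    using one_plus_square_pos[of s] by (simp add: penalty_def pos_less_divide_eq)
qed

text \<open>
  For a positive tilt, no point that is as good as \<open>- pi\<close> can be far from it. On its right
  both the potential and the tilt are at least as large, the latter strictly. On its left, at
  distance \<open>s\<close>, the tilt gains at most \<open>s / 2\<close>. For \<open>pi / 6 \<le> s \<le> 1\<close> this is too little because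
  \<open>cos (3 * s) \<le> 0\<close>, so that a loss of \<open>1\<close> has to be compensated; for \<open>s > 1\<close> the penalty alone exceeds
  the gain.
\<close>

lemma tilt_sublevel:
  assumes t: "0 < t" "t \<le> 1 / 2" and x: "tilt t x \<le> tilt t (- pi)"
  shows "- pi - pi / 6 < x \<and> x \<le> - pi"
proof -
  have le: "tilt t x \<le> - 1 - t * pi"
    using x by (simp add: tilt_def potential_minus_pi)
  have "x \<le> - pi"
  proof (rule ccontr)
    assume "\<not> x \<le> - pi"
    then have "t * (- pi) < t * x" using t by (intro mult_strict_left_mono) auto
    then show False using le potential_ge[of x] by (simp add: tilt_def)
  qed
  moreover have "- pi - pi / 6 < x"
  proof (rule ccontr)
    define s where "s = - pi - x"
    assume "\<not> - pi - pi / 6 < x"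
    then have s: "pi / 6 \<le> s" by (simp add: s_def)
    then have "0 < s" using pi_gt_zero by linarith
    have "x = - pi - s" by (simp add: s_def)
    then have g: "penalty s - cos (3 * s) - t * s \<le> - 1"
      using le tilt_left[of s t] \<open>0 < s\<close> by simp
    have ts: "t * s \<le> s / 2"
      using t \<open>0 < s\<close> mult_right_mono[of t "1/2" s] by simp
    show False
    proof (cases "s \<le> 1")
      case True
      have "cos (3 * s) \<le> 0"
        using cos_ge_zero[of "pi - 3 * s"] s True pi_gt3 by simp
      then show False using g ts True penalty_nonneg[of s] by linarith
    next
      case False
      then have "s / 2 < penalty s" by (intro penalty_ge_half) simp
      moreover have "cos (3 * s) \<le> 1" by simp
      ultimately show False using g ts by linarith
    qed
  qed
  ultimately show ?thesis by simp
qed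

definition penalty' :: "real \<Rightarrow> real" where
  "penalty' s = 2 * s - 2 * s / (1 + s\<^sup>2)\<^sup>2"

definition penalty'' :: "real \<Rightarrow> real" where
  "penalty'' s = 2 - 2 / (1 + s\<^sup>2)\<^sup>2 + 8 * s\<^sup>2 / (1 + s\<^sup>2) ^ 3"

text \<open>
  In this form the penalty is a parabola with a bounded correction, which makes its
  derivatives and its convexity easy to read off.
\<close>

lemma penalty_eq: "penalty s = s\<^sup>2 - 1 + 1 / (1 + s\<^sup>2)"
proof -
  have "s ^ 4 = (s\<^sup>2 - 1) * (1 + s\<^sup>2) + 1"
    by (simp add: power4_eq_xxxx power2_eq_square algebra_simps)
  then show ?thesis
    using one_plus_square_pos[of s] by (simp add: penalty_def add_divide_distrib)
qed

lemma DERIV_penalty: "(penalty has_real_derivative penalty' s) (at s)"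
proof -
  have "1 + s\<^sup>2 \<noteq> 0" using one_plus_square_pos[of s] by simp
  then have "((\<lambda>s. s\<^sup>2 - 1 + 1 / (1 + s\<^sup>2)) has_real_derivative 2 * s + - (2 * s) / ((1 + s\<^sup>2) * (1 + s\<^sup>2))) (at s)"
    by (auto intro!: derivative_eq_intros)
  then show ?thesis
    by (simp add: penalty_eq[abs_def] penalty'_def power2_eq_square[of "1 + s\<^sup>2"])
qed

lemma DERIV_penalty': "(penalty' has_real_derivative penalty'' s) (at s)"
proof -
  define w where "w = 1 + s\<^sup>2"
  have w: "w \<noteq> 0" using one_plus_square_pos[of s] by (simp add: w_def)
  then have "(penalty' has_real_derivative
      2 - (2 * w\<^sup>2 - 2 * s * (2 * w * (2 * s))) / (w\<^sup>2 * w\<^sup>2)) (at s)"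
    unfolding penalty'_def[abs_def] w_def
    by (auto intro!: derivative_eq_intros)
  also have "(2 * w\<^sup>2 - 2 * s * (2 * w * (2 * s))) / (w\<^sup>2 * w\<^sup>2) = 2 / w\<^sup>2 - 8 * s\<^sup>2 / w ^ 3"
    using w by (simp add: diff_divide_distrib power2_eq_square power3_eq_cube)
  finally show ?thesis
    by (simp add: penalty''_def w_def algebra_simps)
qed

lemma penalty''_nonneg: "0 \<le> penalty'' s"
proof -
  have "1 \<le> (1 + s\<^sup>2)\<^sup>2" by simp
  then have "2 / (1 + s\<^sup>2)\<^sup>2 \<le> 2 / 1"
    using one_plus_square_pos[of s] by (intro divide_left_mono) auto
  moreover have "0 \<le> 8 * s\<^sup>2 / (1 + s\<^sup>2) ^ 3" by simp
  ultimately show ?thesis by (simp add: penalty''_def)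
qed

text \<open>
  By \<open>tilt_sublevel\<close> only the window \<open>0 \<le> s < pi / 6\<close> to the left of \<open>- pi\<close> matters, so compactness gives
  existence. On this window \<open>cos (3 * s)\<close> is positive and the penalty is convex, hence the
  tilted potential is strictly convex and has at most one critical point; the endpoint \<open>s = 0\<close> is no
  minimiser because the outward slope there is \<open>- t < 0\<close>.
\<close>

lemma minimizers_pos:
  assumes t: "0 < t" "t \<le> 1 / 2"
  obtains s where "0 < s" "s < pi / 6" "minimizers t = {- pi - s}"
proof -
  define g where "g = (\<lambda>s. penalty s - cos (3 * s) - t * s)"
  define g' where "g' = (\<lambda>s. penalty' s + 3 * sin (3 * s) - t)"
  have g: "(g has_real_derivative g' s) (at s)" for s
    unfolding g_def g'_def by (auto intro!: derivative_eq_intros DERIV_penalty)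
  have g': "(g' has_real_derivative penalty'' s + 9 * cos (3 * s)) (at s)" for s
    unfolding g'_def by (auto intro!: derivative_eq_intros DERIV_penalty')
  have tg: "tilt t (- pi - s) = g s - t * pi" if "0 \<le> s" for s
    using tilt_left[OF that] by (simp add: g_def)
  have "continuous_on {0..pi / 6} g"
    using has_field_derivative_at_within[OF g] by (rule DERIV_continuous_on)
  then obtain r where r: "0 \<le> r" "r \<le> pi / 6" "\<And>s. 0 \<le> s \<Longrightarrow> s \<le> pi / 6 \<Longrightarrow> g r \<le> g s"
    using continuous_attains_inf[of "{0..pi / 6}" g] by force
  have rmin: "- pi - r \<in> minimizers t"
    unfolding minimizers_def
  proof safe
    fix y
    show "tilt t (- pi - r) \<le> tilt t y"
    proof (cases "tilt t y \<le> tilt t (- pi)")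
      case True
      from tilt_sublevel[OF t True] r(3)[of "- pi - y"] tg[of "- pi - y"] tg[of r] r(1)
      show ?thesis by simp
    next
      case False
      then show ?thesis using r(3)[of 0] tg[of 0] tg[of r] r(1) by simp
    qed
  qed
  have crit: "\<exists>s. 0 < s \<and> s < pi / 6 \<and> g' s = 0 \<and> x = - pi - s" if x: "x \<in> minimizers t" for x
  proof -
    define s where "s = - pi - x"
    have xs: "x = - pi - s" by (simp add: s_def)
    have min: "tilt t x \<le> tilt t y" for y using x by (auto simp: minimizers_def)
    from tilt_sublevel[OF t min] have s: "0 \<le> s" "s < pi / 6" by (auto simp: s_def)
    have gmin: "g s \<le> g y" if "0 \<le> y" for y
      using min[of "- pi - y"] tg[OF that] tg[OF s(1)] by (simp add: xs)
    have "s \<noteq> 0"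
    proof
      assume "s = 0"
      have "g' 0 < 0" using t by (simp add: g'_def penalty'_def)
      from DERIV_neg_dec_right[OF g this] obtain d where
        "0 < d" "\<And>h. 0 < h \<Longrightarrow> h < d \<Longrightarrow> g h < g 0" by auto
      from this(2)[of "d / 2"] this(1) gmin[of "d / 2"] \<open>s = 0\<close> show False by simp
    qed
    with s have "0 < s" by simp
    \<comment> \<open>\<open>g\<close> describes the tilted potential only at nonnegative arguments; the radius \<open>s\<close> stays in that range\<close>
    moreover from this have "g' s = 0"
      by (intro DERIV_local_min[OF g, of s s]) (auto intro!: gmin)
    ultimately show ?thesis using s xs by blast
  qed
  \<comment> \<open>strict convexity on the window\<close>
  have incr: "g' a < g' b" if "0 < a" "a < b" "b < pi / 6" for a b
  proof (rule DERIV_pos_imp_increasing[OF \<open>a < b\<close>])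
    fix c assume c: "a \<le> c" "c \<le> b"
    have "0 < cos (3 * c)" using that c by (intro cos_gt_zero) auto
    then have "0 < penalty'' c + 9 * cos (3 * c)" using penalty''_nonneg[of c] by linarith
    with g' show "\<exists>y. (g' has_real_derivative y) (at c) \<and> 0 < y" by blast
  qed
  have "x = - pi - r" if x: "x \<in> minimizers t" for x
  proof -
    obtain s where s: "0 < s" "s < pi / 6" "g' s = 0" "x = - pi - s" using crit[OF x] by blast
    obtain q where q: "0 < q" "q < pi / 6" "g' q = 0" "- pi - r = - pi - q" using crit[OF rmin] by blast
    have "s = q" using incr[of s q] incr[of q s] s q by (cases s q rule: linorder_cases) auto
    then show ?thesis using s q by simp
  qed
  then have "minimizers t = {- pi - r}" using rmin by blast
  moreover have "0 < r" "r < pi / 6" using crit[OF rmin] by auto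
  ultimately show ?thesis using that by blast
qed

text \<open>
  Minimality is tested against the competitor \<open>- pi\<close>.
\<close>

lemma potential_left_bound:
  assumes t: "0 < t" and s: "0 < s" and x: "- pi - s \<in> minimizers t"
  shows "potential (- pi - s) + 1 \<le> t * s"
proof -
  have "tilt t (- pi - s) \<le> tilt t (- pi)" using x by (simp add: minimizers_def)
  then show ?thesis by (simp add: tilt_def potential_minus_pi algebra_simps)
qed

text \<open>
  The cubic estimate makes the minimiser converge to \<open>\<plusminus> pi\<close> as the tilt vanishes: the excess of the
  potential is at least the penalty, of order \<open>s ^ 4\<close>, and at most \<open>\<bar>t\<bar> * s\<close>.
\<close>

lemma minimizers_unique:
  assumes "t \<noteq> 0" "\<bar>t\<bar> \<le> 1 / 2"
  obtains s where "0 < s" "s < pi / 6" "s ^ 3 \<le> 2 * \<bar>t\<bar>"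
    "minimizers t = {- sgn t * (pi + s)}" "potential (pi + s) + 1 \<le> \<bar>t\<bar> * s"
proof -
  obtain s where s: "0 < s" "s < pi / 6" "minimizers \<bar>t\<bar> = {- pi - s}"
    using assms by (auto intro: minimizers_pos[of "\<bar>t\<bar>"])
  have bound: "potential (pi + s) + 1 \<le> \<bar>t\<bar> * s"
    using potential_left_bound[of "\<bar>t\<bar>" s] s assms potential_even[of "pi + s"] by simp
  have "s \<le> 1" using s pi_less_4 by linarith
  have "penalty s \<le> \<bar>t\<bar> * s"
    using bound potential_outer[of s] s(1) cos_le_one[of "3 * s"] by linarith
  then have "s * s ^ 3 \<le> s * (\<bar>t\<bar> * (1 + s\<^sup>2))"
    using one_plus_square_pos[of s] by (simp add: penalty_def field_simps power4_eq_xxxx power3_eq_cube)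
  then have "s ^ 3 \<le> \<bar>t\<bar> * (1 + s\<^sup>2)" using s(1) by simp
  also have "\<dots> \<le> \<bar>t\<bar> * 2" using s(1) \<open>s \<le> 1\<close> by (intro mult_left_mono) (auto simp: power_le_one)
  finally have "s ^ 3 \<le> 2 * \<bar>t\<bar>" by simp
  moreover have "minimizers t = {- sgn t * (pi + s)}"
  proof (cases "0 < t")
    case True
    then show ?thesis using s(3) by simp
  next
    case False
    then have "t = - \<bar>t\<bar>" "sgn t = - 1" using assms(1) by auto
    then show ?thesis using minimizers_reflect[of "\<bar>t\<bar>"] s(3) by simp
  qed
  ultimately show ?thesis using that s bound by blast
qed

text \<open>
  The potential is given by different formulas on different intervals, so its derivatives are
  computed on an open set where a single formula is valid.
\<close>

lemma deriv2_eq: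
  fixes f :: "real \<Rightarrow> real"
  assumes "open S" "x \<in> S"
    and eq: "\<And>y. y \<in> S \<Longrightarrow> f y = penalty (y - c) + cos (3 * y) + t * y"
  shows "deriv (deriv f) x = penalty'' (x - c) - 9 * cos (3 * x)"
proof -
  have "((\<lambda>y. penalty (y - c)) has_real_derivative penalty' (y - c)) (at y)" for y
    using DERIV_shift[of penalty "penalty' (y - c)" y "- c"] DERIV_penalty[of "y - c"] by simp
  then have "((\<lambda>y. penalty (y - c) + cos (3 * y) + t * y)
      has_real_derivative penalty' (y - c) - 3 * sin (3 * y) + t) (at y)" for y
    by (auto intro!: derivative_eq_intros)
  from has_field_derivative_transform_within_open[OF this \<open>open S\<close> _ eq[symmetric]]
  have "deriv f y = penalty' (y - c) - 3 * sin (3 * y) + t" if "y \<in> S" for y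
    using that by (blast intro: DERIV_imp_deriv)
  note deriv_f = this
  have "((\<lambda>y. penalty' (y - c)) has_real_derivative penalty'' (x - c)) (at x)"
    using DERIV_shift[of penalty' "penalty'' (x - c)" x "- c"] DERIV_penalty'[of "x - c"] by simp
  then have "((\<lambda>y. penalty' (y - c) - 3 * sin (3 * y) + t)
      has_real_derivative penalty'' (x - c) - 9 * cos (3 * x)) (at x)"
    by (auto intro!: derivative_eq_intros)
  from has_field_derivative_transform_within_open[OF this \<open>open S\<close> \<open>x \<in> S\<close> deriv_f[symmetric]]
  show ?thesis
    by (rule DERIV_imp_deriv)
qed

text \<open>
  A nonzero second derivative at the minimiser is what gives it a nonzero Laplace weight.
\<close>

lemma tilt_deriv2_pos:
  assumes "\<sigma> = 1 \<or> \<sigma> = - 1" "0 < s" "s < pi / 6"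
  shows "0 < deriv (deriv (tilt t)) (\<sigma> * (pi + s))"
proof -
  have "deriv (deriv (tilt t)) (\<sigma> * (pi + s)) = penalty'' (\<sigma> * (pi + s) - \<sigma> * pi) - 9 * cos (3 * (\<sigma> * (pi + s)))"
  proof (rule disjE[OF assms(1)])
    assume \<sigma>: "\<sigma> = 1"
    have "\<not> y < - pi" if "pi < y" for y using that pi_gt_zero by linarith
    then have "tilt t y = penalty (y - \<sigma> * pi) + cos (3 * y) + t * y" if "y \<in> {pi<..}" for y
      using that \<sigma> by (simp add: tilt_def potential_eq)
    then show ?thesis
      using \<sigma> assms(2) by (intro deriv2_eq[of "{pi<..}" _ _ _ t]) auto
  next
    assume \<sigma>: "\<sigma> = - 1"
    have "tilt t y = penalty (y - \<sigma> * pi) + cos (3 * y) + t * y" if "y \<in> {..<- pi}" for y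
      using that \<sigma> by (simp add: tilt_def potential_eq)
    then show ?thesis
      using \<sigma> assms(2) by (intro deriv2_eq[of "{..<- pi}" _ _ _ t]) auto
  qed
  moreover have "cos (3 * (\<sigma> * (pi + s))) = - cos (3 * s)"
    using assms(1) cos_triple_plus_pi[of s] cos_minus[of "3 * (pi + s)"] by auto
  moreover have "0 < cos (3 * s)" using assms by (intro cos_gt_zero) auto
  ultimately show ?thesis using penalty''_nonneg[of "\<sigma> * (pi + s) - \<sigma> * pi"] by linarith
qed

section \<open>The mean of a uniform sample\<close>

lemma emeasure_Z: "emeasure lborel Z = 1"
  by (simp add: Z_def)

lemma Z_borel [measurable]: "Z \<in> sets borel"
  by (simp add: Z_def)

text \<open>
  The interval \<open>Z\<close> has length one, so normalising Lebesgue measure changes nothing.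
\<close>

lemma mu_eq: "mu = restrict_space lborel Z"
proof (rule measure_eqI)
  show "sets mu = sets (restrict_space lborel Z)"
    by (simp add: mu_def sets_restrict_space)
  fix A assume "A \<in> sets mu"
  then have A: "A \<subseteq> Z" "A \<in> sets borel"
    by (auto simp: mu_def sets_restrict_space_iff)
  then have "Z \<inter> A = A" by auto
  with A show "emeasure mu A = emeasure (restrict_space lborel Z) A"
    by (simp add: mu_def emeasure_restrict_space emeasure_Z divide_ennreal_def)
qed

lemma space_mu [simp]: "space mu = Z"
  by (simp add: mu_def)

lemma id_measurable_mu [measurable]: "(\<lambda>z. z) \<in> borel_measurable mu"
  unfolding mu_eq by (intro measurable_restrict_space1) simp

lemma prob_space_mu: "prob_space mu"
  by (rule prob_spaceI) (simp add: mu_eq emeasure_restrict_space emeasure_Z)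

lemma abs_le_mu: "z \<in> space mu \<Longrightarrow> \<bar>z\<bar> \<le> 1 / 2"
  by (auto simp: Z_def)

lemma integral_power_mu: "(\<integral>z. z ^ k \<partial>mu) = ((1 / 2) ^ Suc k - (- 1 / 2) ^ Suc k) / Suc k"
proof -
  have "(\<integral>z. z ^ k \<partial>mu) = (\<integral>z. z ^ k * indicator {- 1 / 2..1 / 2} z \<partial>lborel)"
    by (simp add: mu_eq integral_restrict_space Z_def mult.commute)
  then show ?thesis by (simp add: integral_power)
qed

lemma mean_mu: "(\<integral>z. z \<partial>mu) = 0"
  using integral_power_mu[of 1] by (simp add: power2_eq_square)

lemma second_moment_mu: "(\<integral>z. z\<^sup>2 \<partial>mu) = 1 / 12"
  using integral_power_mu[of 2] by (simp add: power3_eq_cube eval_nat_numeral)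

lemma AE_mu_neq: "AE z in mu. z \<noteq> a"
proof (rule AE_I')
  have "emeasure mu {a} = 0" if "a \<in> Z"
    using that by (simp add: mu_eq emeasure_restrict_space)
  then show "{a} \<inter> Z \<in> null_sets mu"
    by (cases "a \<in> Z") (auto simp: null_sets_def mu_def sets_restrict_space_iff)
qed auto

lemma uminus_measurable_mu [measurable]: "uminus \<in> measurable mu mu"
  unfolding mu_eq by (intro measurable_restrict_space3) (auto simp: Z_def)

lemma distr_uminus_mu: "distr mu mu uminus = mu"
proof (rule measure_eqI)
  have Zm: "- z \<in> Z \<longleftrightarrow> z \<in> Z" for z by (auto simp: Z_def)
  fix A assume "A \<in> sets (distr mu mu uminus)"
  then have A: "A \<in> sets mu" by simp
  then have AZ: "A \<subseteq> Z" "A \<in> sets borel"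
    by (auto simp: mu_def sets_restrict_space_iff)
  have "uminus -` A \<subseteq> Z" using AZ Zm by auto
  moreover have "emeasure (distr mu mu uminus) A = emeasure mu (uminus -` A \<inter> Z)"
    using A by (simp add: emeasure_distr)
  ultimately have "emeasure (distr mu mu uminus) A = emeasure lborel (uminus -` A)"
    by (simp add: Int_absorb2 mu_eq emeasure_restrict_space)
  also have "\<dots> = emeasure (distr lborel borel uminus) A"
    using AZ by (simp add: emeasure_distr)
  also have "\<dots> = emeasure mu A"
    using AZ by (simp add: lborel_distr_uminus mu_eq emeasure_restrict_space)
  finally show "emeasure (distr mu mu uminus) A = emeasure mu A" .
qed simp

abbreviation sample :: "'i set \<Rightarrow> ('i \<Rightarrow> real) measure" where
  "sample I \<equiv> PiM I (\<lambda>_. mu)"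

interpretation mu: prob_space mu
  by (rule prob_space_mu)

interpretation mu_product: product_sigma_finite "\<lambda>_. mu"
  by (intro product_sigma_finite.intro mu.sigma_finite_measure_axioms)

lemma prob_space_sample: "prob_space (sample I)"
  by (intro prob_space_PiM prob_space_mu)

lemma sample_component_measurable [measurable]:
  assumes "i \<in> I"
  shows "(\<lambda>z. z i) \<in> borel_measurable (sample I)"
  using measurable_compose[OF measurable_component_singleton[OF assms] id_measurable_mu] .

lemma sample_sum_measurable [measurable]:
  "(\<lambda>z. \<Sum>i\<in>I. z i) \<in> borel_measurable (sample I)"
  by (intro borel_measurable_sum) measurable

lemma sample_sum_bound:
  assumes "z \<in> space (sample I)"
  shows "\<bar>\<Sum>i\<in>I. z i\<bar> \<le> card I / 2"
proof -
  have "\<bar>\<Sum>i\<in>I. z i\<bar> \<le> (\<Sum>i\<in>I. \<bar>z i\<bar>)" by (rule sum_abs)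
  also have "\<dots> \<le> (\<Sum>i\<in>I. 1 / 2)"
    using assms abs_le_mu by (intro sum_mono) (auto simp: space_PiM PiE_iff)
  finally show ?thesis by simp
qed

lemma prob_mu_Z [simp]: "mu.prob Z = 1"
  using mu.prob_space by simp

lemma integrable_mu: "integrable mu (\<lambda>z. z)"
  by (rule mu.integrable_const_bound[where B = "1 / 2"]) (use abs_le_mu in force)+

text \<open>
  Adding a coordinate \<open>y\<close> to a sum \<open>S\<close> contributes \<open>y\<^sup>2 + 2 * S * y\<close> to the square; integrating over
  \<open>y\<close> kills the cross term because \<open>mu\<close> is centred.
\<close>

lemma sample_sum_second_moment:
  assumes "finite I"
  shows "(\<integral>z. (\<Sum>i\<in>I. z i)\<^sup>2 \<partial>sample I) = card I / 12"
  using assms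
proof (induction I)
  case empty
  then show ?case by simp
next
  case (insert j I)
  interpret I: prob_space "sample I" by (rule prob_space_sample)
  interpret J: prob_space "sample (insert j I)" by (rule prob_space_sample)
  have int2: "integrable mu (\<lambda>z. z\<^sup>2)"
  proof (intro mu.integrable_const_bound[where B = "(1 / 2)\<^sup>2"] AE_I2)
    fix y assume "y \<in> space mu"
    then have "\<bar>y\<bar>\<^sup>2 \<le> (1 / 2)\<^sup>2" by (intro power_mono abs_le_mu) auto
    then show "norm (y\<^sup>2) \<le> (1 / 2)\<^sup>2" by simp
  qed measurable
  have intS: "integrable (sample K) (\<lambda>z. (\<Sum>i\<in>K. z i)\<^sup>2)" for K :: "'a set"
  proof -
    interpret K: prob_space "sample K" by (rule prob_space_sample)
    show ?thesis
      using sample_sum_bound[of _ K]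
      by (intro K.integrable_const_bound[where B = "(card K / 2)\<^sup>2"])
        (auto simp flip: abs_le_square_iff)
  qed
  have "(\<integral>z. (\<Sum>i\<in>insert j I. z i)\<^sup>2 \<partial>sample (insert j I))
      = (\<integral>z. \<integral>y. (\<Sum>i\<in>insert j I. (z(j := y)) i)\<^sup>2 \<partial>mu \<partial>sample I)"
    by (rule mu_product.product_integral_insert[OF insert(1,2) intS])
  also have "\<dots> = (\<integral>z. (\<Sum>i\<in>I. z i)\<^sup>2 + 1 / 12 \<partial>sample I)"
  proof (intro Bochner_Integration.integral_cong refl)
    fix z :: "'a \<Rightarrow> real"
    have "(\<Sum>i\<in>insert j I. (z(j := y)) i) = y + (\<Sum>i\<in>I. z i)" for y
      using insert(1,2) by (auto intro!: sum.cong)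
    then have "(\<integral>y. (\<Sum>i\<in>insert j I. (z(j := y)) i)\<^sup>2 \<partial>mu)
        = (\<integral>y. (y\<^sup>2 + 2 * (\<Sum>i\<in>I. z i) * y) + (\<Sum>i\<in>I. z i)\<^sup>2 \<partial>mu)"
      by (simp add: power2_sum algebra_simps)
    also have "\<dots> = (\<Sum>i\<in>I. z i)\<^sup>2 + 1 / 12"
      using integrable_mu int2 by (simp add: mean_mu second_moment_mu)
    finally show "(\<integral>y. (\<Sum>i\<in>insert j I. (z(j := y)) i)\<^sup>2 \<partial>mu) = (\<Sum>i\<in>I. z i)\<^sup>2 + 1 / 12" .
  qed
  also have "\<dots> = card I / 12 + 1 / 12"
    using intS insert.IH by (simp add: I.prob_space)
  finally show ?case using insert(1,2) by (simp add: add_divide_distrib)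
qed

text \<open>
  Given all coordinates but one, the sum vanishes for a single value of the remaining one, and \<open>mu\<close>
  has no atoms.
\<close>

lemma AE_sample_sum_nonzero:
  assumes "finite I" "I \<noteq> {}"
  shows "AE z in sample I. (\<Sum>i\<in>I. z i) \<noteq> 0"
proof -
  obtain j where "j \<in> I" using assms by blast
  define J where "J = I - {j}"
  have I: "I = insert j J" "j \<notin> J" "finite J"
    using \<open>j \<in> I\<close> assms by (auto simp: J_def)
  have "emeasure (sample I) {z \<in> space (sample I). (\<Sum>i\<in>I. z i) = 0}
      = (\<integral>\<^sup>+z. indicator {z \<in> space (sample I). (\<Sum>i\<in>I. z i) = 0} z \<partial>sample I)"
    by simp
  also have "\<dots> = (\<integral>\<^sup>+z. indicator {0} (\<Sum>i\<in>I. z i) \<partial>sample I)"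
    by (intro nn_integral_cong) (auto simp: indicator_def)
  also have "\<dots> = (\<integral>\<^sup>+z. \<integral>\<^sup>+y. indicator {0} (\<Sum>i\<in>I. (z(j := y)) i) \<partial>mu \<partial>sample J)"
    unfolding I(1) by (intro mu_product.product_nn_integral_insert I) measurable
  also have "\<dots> = (\<integral>\<^sup>+z. 0 \<partial>sample J)"
  proof (intro nn_integral_cong)
    fix z :: "'a \<Rightarrow> real"
    have "(\<Sum>i\<in>I. (z(j := y)) i) = y + (\<Sum>i\<in>J. z i)" for y
      unfolding I(1) using I(2,3) by (auto intro!: sum.cong)
    then have "(\<integral>\<^sup>+y. indicator {0} (\<Sum>i\<in>I. (z(j := y)) i) \<partial>mu) = (\<integral>\<^sup>+y. 0 \<partial>mu)"
      using AE_mu_neq[of "- (\<Sum>i\<in>J. z i)"]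
      by (intro nn_integral_cong_AE) (auto split: split_indicator)
    then show "(\<integral>\<^sup>+y. indicator {0} (\<Sum>i\<in>I. (z(j := y)) i) \<partial>mu) = 0" by simp
  qed
  finally show ?thesis
    by (subst AE_iff_measurable[OF _ refl]) auto
qed

text \<open>
  The product measure is invariant under changing the sign of all coordinates at once.
\<close>

lemma sample_sum_sign_symmetric:
  assumes "finite I"
  shows "measure (sample I) {z \<in> space (sample I). (\<Sum>i\<in>I. z i) < 0}
       = measure (sample I) {z \<in> space (sample I). 0 < (\<Sum>i\<in>I. z i)}"
proof -
  have mc: "compose I uminus \<in> measurable (sample I) (sample I)"
    unfolding compose_def
    by (intro measurable_restrict measurable_compose[OF _ uminus_measurable_mu]) measurable
  have eq: "distr (sample I) (sample I) (compose I uminus) = sample I"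
    using distr_PiM_finite_prob_space'[OF assms, of "\<lambda>_. mu" "\<lambda>_. mu" uminus] prob_space_mu uminus_measurable_mu
    by (simp add: distr_uminus_mu)
  have s: "(\<Sum>i\<in>I. compose I uminus z i) = - (\<Sum>i\<in>I. z i)" for z :: "'a \<Rightarrow> real"
    by (simp add: compose_def sum_negf)
  have "measure (sample I) {z \<in> space (sample I). (\<Sum>i\<in>I. z i) < 0}
      = measure (distr (sample I) (sample I) (compose I uminus)) {z \<in> space (sample I). (\<Sum>i\<in>I. z i) < 0}"
    by (simp add: eq)
  also have "\<dots> = measure (sample I) (compose I uminus -` {z \<in> space (sample I). (\<Sum>i\<in>I. z i) < 0} \<inter> space (sample I))"
    by (intro measure_distr mc) measurable
  also have "compose I uminus -` {z \<in> space (sample I). (\<Sum>i\<in>I. z i) < 0} \<inter> space (sample I)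
      = {z \<in> space (sample I). 0 < (\<Sum>i\<in>I. z i)}"
    using measurable_space[OF mc] by (auto simp: s)
  finally show ?thesis .
qed

section \<open>The law of the empirical minimiser\<close>

text \<open>
  Rewriting \<open>1\<close> to \<open>Suc 0\<close> would turn the index set \<open>{1..n}\<close> of the samples into \<open>{Suc 0..n}\<close>, which the
  facts below do not match.
\<close>

declare One_nat_def [simp del]

definition sample_mean :: "nat \<Rightarrow> (nat \<Rightarrow> real) \<Rightarrow> real" where
  "sample_mean n z = (1 / real n) * (\<Sum>i=1..n. z i)"

definition minimizer :: "real \<Rightarrow> real" where
  "minimizer t = (SOME x. x \<in> minimizers t)"

lemma emp_fun_eq:
  assumes "1 \<le> n"
  shows "emp_fun u n x z = tilt (sample_mean n z) x"
proof -
  have "(\<Sum>i=1..n. u x (z i)) = real n * potential x + (\<Sum>i=1..n. z i) * x"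
    by (simp add: u_eq_tilt tilt_def sum.distrib sum_distrib_right)
  then show ?thesis
    using assms by (simp add: emp_fun_def tilt_def sample_mean_def distrib_left)
qed

lemma emp_argmin_eq: "1 \<le> n \<Longrightarrow> emp_argmin u n z = minimizers (sample_mean n z)"
  by (simp add: emp_argmin_def is_arg_min_linorder minimizers_def emp_fun_eq)

text \<open>
  At \<open>t = 0\<close> there are several minimisers and \<open>minimizer\<close> picks any one of them.
\<close>

lemma minimizer_in:
  assumes "\<bar>t\<bar> \<le> 1 / 2"
  shows "minimizer t \<in> minimizers t"
proof -
  have "minimizers t \<noteq> {}"
  proof (cases "t = 0")
    case True
    have "- pi \<in> minimizers 0"
      by (simp add: minimizers_def tilt_def potential_minus_pi potential_ge)
    with True show ?thesis by blast
  next
    case False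
    then show ?thesis using assms by (auto elim: minimizers_unique)
  qed
  then show ?thesis unfolding minimizer_def by (auto intro: someI)
qed

lemma minimizer_cases:
  assumes "t \<noteq> 0" "\<bar>t\<bar> \<le> 1 / 2"
  obtains s where "0 < s" "s < pi / 6" "s ^ 3 \<le> 2 * \<bar>t\<bar>" "minimizers t = {minimizer t}"
    "minimizer t = - sgn t * (pi + s)" "potential (minimizer t) + 1 \<le> \<bar>t\<bar> * s"
proof -
  obtain s where s: "0 < s" "s < pi / 6" "s ^ 3 \<le> 2 * \<bar>t\<bar>"
    "minimizers t = {- sgn t * (pi + s)}" "potential (pi + s) + 1 \<le> \<bar>t\<bar> * s"
    using minimizers_unique[OF assms] by blast
  have m: "minimizer t = - sgn t * (pi + s)" using minimizer_in[OF assms(2)] s(4) by simp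
  moreover have "potential (minimizer t) = potential (pi + s)"
    using assms(1) potential_even[of "pi + s"] unfolding m by (cases "0 < t") simp_all
  ultimately show ?thesis using that s by simp
qed

text \<open>
  Adding the two minimality inequalities cancels the potential, which leaves
  \<open>(t' - t) * (minimizer t' - minimizer t) \<le> 0\<close>. Measurability of \<open>minimizer\<close> follows from this monotonicity.
\<close>

lemma minimizer_antimono:
  assumes "\<bar>t\<bar> \<le> 1 / 2" "\<bar>t'\<bar> \<le> 1 / 2" "t \<le> t'"
  shows "minimizer t' \<le> minimizer t"
proof (rule ccontr)
  assume "\<not> minimizer t' \<le> minimizer t"
  then have less: "minimizer t < minimizer t'" by simp
  have "tilt t (minimizer t) \<le> tilt t (minimizer t')"
    using minimizer_in[OF assms(1)] unfolding minimizers_def by blast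
  moreover have "tilt t' (minimizer t') \<le> tilt t' (minimizer t)"
    using minimizer_in[OF assms(2)] unfolding minimizers_def by blast
  ultimately have "(t' - t) * (minimizer t' - minimizer t) \<le> 0"
    unfolding tilt_def left_diff_distrib right_diff_distrib by linarith
  moreover have "t < t'" using assms(3) less by (cases "t = t'") auto
  ultimately show False using less by (simp add: mult_le_0_iff)
qed

lemma minimizer_measurable:
  "minimizer \<in> borel_measurable (restrict_space borel {- 1 / 2..1 / 2})"
proof -
  have "mono_on {- 1 / 2..1 / 2} (\<lambda>t. - minimizer t)"
  proof (rule mono_onI)
    fix t t' :: real
    assume "t \<in> {- 1 / 2..1 / 2}" "t' \<in> {- 1 / 2..1 / 2}" "t \<le> t'"
    then have "minimizer t' \<le> minimizer t"
      by (intro minimizer_antimono) (simp_all add: abs_le_iff)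
    then show "- minimizer t \<le> - minimizer t'" by (rule le_imp_neg_le)
  qed
  from borel_measurable_mono_on_fnc[OF this] show ?thesis
    by (rule borel_measurable_uminus_eq[THEN iffD1])
qed

text \<open>
  A single minimiser with nonzero weight carries all the mass after normalisation.
\<close>

lemma S0_eq_return:
  assumes n: "1 \<le> n" and t: "sample_mean n z \<noteq> 0" "\<bar>sample_mean n z\<bar> \<le> 1 / 2"
  shows "S0 u n z = return borel (minimizer (sample_mean n z))"
proof -
  define t where "t = sample_mean n z"
  from minimizer_cases[OF t, folded t_def] obtain s where
    s: "0 < s" "s < pi / 6" "minimizers t = {minimizer t}" "minimizer t = - sgn t * (pi + s)"
    by blast
  have "- sgn t = 1 \<or> - sgn t = - 1" using t by (auto simp: sgn_if t_def)
  from tilt_deriv2_pos[OF this s(1,2), of t]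
  have w: "laplace_weight u n z (minimizer t) \<noteq> 0"
    unfolding laplace_weight_def emp_fun_eq[OF n] t_def[symmetric] s(4)[symmetric] by simp
  have "ennreal ((\<Sum>x\<in>emp_argmin u n z \<inter> A. laplace_weight u n z x)
      / (\<Sum>x\<in>emp_argmin u n z. laplace_weight u n z x)) = indicator A (minimizer t)" for A
    unfolding emp_argmin_eq[OF n] t_def[symmetric] s(3)
    using w by (cases "minimizer t \<in> A") auto
  then show ?thesis by (simp add: S0_def return_def t_def)
qed

lemma sample_mean_measurable [measurable]: "sample_mean n \<in> borel_measurable (sample {1..n})"
  unfolding sample_mean_def by measurable

lemma sample_mean_bound:
  assumes "z \<in> space (sample {1..n})"
  shows "\<bar>sample_mean n z\<bar> \<le> 1 / 2"
proof (cases "n = 0")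
  case False
  then have "\<bar>sample_mean n z\<bar> = \<bar>\<Sum>i=1..n. z i\<bar> / n" by (simp add: sample_mean_def)
  also have "\<dots> \<le> (n / 2) / n" using sample_sum_bound[OF assms] by (intro divide_right_mono) auto
  finally show ?thesis using False by simp
qed (simp add: sample_mean_def)

lemma minimizer_mean_measurable:
  "(\<lambda>z. minimizer (sample_mean n z)) \<in> borel_measurable (sample {1..n})"
proof (rule measurable_compose[OF _ minimizer_measurable])
  show "sample_mean n \<in> measurable (sample {1..n}) (restrict_space borel {- 1 / 2..1 / 2})"
  proof (rule measurable_restrict_space2)
    show "sample_mean n \<in> space (sample {1..n}) \<rightarrow> {- 1 / 2..1 / 2}"
    proof
      fix z assume "z \<in> space (sample {1..n})"
      from sample_mean_bound[OF this] show "sample_mean n z \<in> {- 1 / 2..1 / 2}"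
        unfolding atLeastAtMost_iff by linarith
    qed
  qed (rule sample_mean_measurable)
qed

lemma
  shows sets_minimizer_le: "{z \<in> space (sample {1..n}). minimizer (sample_mean n z) \<le> x} \<in> sets (sample {1..n})"
    and sets_minimizer_far: "{z \<in> space (sample {1..n}). x \<le> \<bar>minimizer (sample_mean n z)\<bar>} \<in> sets (sample {1..n})"
    and sets_mean_pos: "{z \<in> space (sample {1..n}). 0 < sample_mean n z} \<in> sets (sample {1..n})"
    and sets_mean_neg: "{z \<in> space (sample {1..n}). sample_mean n z < 0} \<in> sets (sample {1..n})"
    and sets_mean_large: "{z \<in> space (sample {1..n}). x \<le> \<bar>sample_mean n z\<bar>} \<in> sets (sample {1..n})"
  by (intro borel_measurable_le borel_measurable_less borel_measurable_abs borel_measurable_const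
      minimizer_mean_measurable sample_mean_measurable)+

lemma AE_sample_mean:
  assumes "1 \<le> n"
  shows "AE z in sample {1..n}. sample_mean n z \<noteq> 0 \<and> \<bar>sample_mean n z\<bar> \<le> 1 / 2"
proof -
  have "AE z in sample {1..n}. (\<Sum>i=1..n. z i) \<noteq> 0"
    using assms by (intro AE_sample_sum_nonzero) auto
  from this AE_space show ?thesis
  proof eventually_elim
    case (elim z)
    from elim(1) have "sample_mean n z \<noteq> 0" using assms by (simp add: sample_mean_def)
    moreover note sample_mean_bound[OF elim(2)]
    ultimately show ?case ..
  qed
qed

lemma mixed_S0_eq_distr:
  assumes "1 \<le> n"
  shows "mixed_S0 mu u n = distr (sample {1..n}) borel (\<lambda>z. minimizer (sample_mean n z))"
    (is "_ = ?D")
proof -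
  have "mixed_S0 mu u n = measure_of UNIV (sets borel) (emeasure ?D)"
    unfolding mixed_S0_def
  proof (rule measure_of_eq)
    fix A :: "real set" assume "A \<in> sigma_sets UNIV (sets borel)"
    then have A [measurable]: "A \<in> sets borel"
      using sets.sigma_sets_eq[of "borel :: real measure"] by simp
    have "(\<integral>\<^sup>+z. emeasure (S0 u n z) A \<partial>sample {1..n})
        = (\<integral>\<^sup>+z. indicator A (minimizer (sample_mean n z)) \<partial>sample {1..n})"
    proof (rule nn_integral_cong_AE)
      show "AE z in sample {1..n}. emeasure (S0 u n z) A = indicator A (minimizer (sample_mean n z))"
        using AE_sample_mean[OF assms]
      proof eventually_elim
        case (elim z)
        then have "S0 u n z = return borel (minimizer (sample_mean n z))"
          by (intro S0_eq_return assms) auto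
        then show ?case using A by simp
      qed
    qed
    also have "\<dots> = (\<integral>\<^sup>+x. indicator A x \<partial>?D)"
      by (rule nn_integral_distr[OF minimizer_mean_measurable, symmetric]) simp
    also have "\<dots> = emeasure ?D A" by (rule nn_integral_indicator) simp
    finally show "(\<integral>\<^sup>+z. emeasure (S0 u n z) A \<partial>sample {1..n}) = emeasure ?D A" .
  qed simp
  also have "\<dots> = ?D"
    using measure_of_of_measure[of ?D] unfolding space_distr sets_distr space_borel .
  finally show ?thesis .
qed

lemma integrable_sample_mean_power: "integrable (sample {1..n}) (\<lambda>z. \<bar>sample_mean n z\<bar> ^ k)"
proof -
  interpret prob_space "sample {1..n}" by (rule prob_space_sample)
  show ?thesis
  proof (rule integrable_const_bound[where B = "(1 / 2) ^ k"], rule AE_I2)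
    fix z assume "z \<in> space (sample {1..n})"
    then have "\<bar>sample_mean n z\<bar> ^ k \<le> (1 / 2) ^ k"
      by (intro power_mono sample_mean_bound) auto
    then show "norm (\<bar>sample_mean n z\<bar> ^ k) \<le> (1 / 2) ^ k"
      by (simp add: power_abs)
  qed (intro borel_measurable_power borel_measurable_abs sample_mean_measurable)
qed

lemma sample_mean_second_moment:
  assumes "1 \<le> n"
  shows "(\<integral>z. (sample_mean n z)\<^sup>2 \<partial>sample {1..n}) = 1 / (12 * real n)"
proof -
  have "(\<integral>z. (sample_mean n z)\<^sup>2 \<partial>sample {1..n}) = (1 / real n)\<^sup>2 * (real n / 12)"
    unfolding sample_mean_def power_mult_distrib using sample_sum_second_moment[of "{1..n}"] by simp
  then show ?thesis using assms by (simp add: power2_eq_square)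
qed

text \<open>
  The inequality \<open>\<bar>t\<bar> \<le> c / 2 * t\<^sup>2 + 1 / (2 * c)\<close> holds for every \<open>c > 0\<close>; integrated with
  \<open>c = sqrt (12 * n)\<close>, the inverse standard deviation, it yields the bound of the first moment by the
  second one.
\<close>

lemma sample_mean_first_absolute_moment:
  assumes "1 \<le> n"
  shows "(\<integral>z. \<bar>sample_mean n z\<bar> \<partial>sample {1..n}) \<le> 1 / sqrt (12 * real n)"
proof -
  interpret prob_space "sample {1..n}" by (rule prob_space_sample)
  define c where "c = sqrt (12 * real n)"
  have c: "0 < c" "c\<^sup>2 = 12 * real n" using assms by (auto simp: c_def)
  note int = integrable_sample_mean_power[of n 1, simplified] integrable_sample_mean_power[of n 2, simplified]
  have "\<bar>t\<bar> \<le> c / 2 * t\<^sup>2 + 1 / (2 * c)" for t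
  proof -
    have "0 \<le> (c * \<bar>t\<bar> - 1)\<^sup>2" by simp
    then have "\<bar>t\<bar> * (2 * c) \<le> c\<^sup>2 * t\<^sup>2 + 1"
      by (simp add: power2_diff power_mult_distrib mult.left_commute mult.commute)
    then have "\<bar>t\<bar> \<le> (c\<^sup>2 * t\<^sup>2 + 1) / (2 * c)"
      using c(1) by (subst pos_le_divide_eq) auto
    also have "\<dots> = c / 2 * t\<^sup>2 + 1 / (2 * c)"
      using c(1) by (simp add: add_divide_distrib power2_eq_square)
    finally show ?thesis .
  qed
  then have "(\<integral>z. \<bar>sample_mean n z\<bar> \<partial>sample {1..n})
      \<le> (\<integral>z. c / 2 * (sample_mean n z)\<^sup>2 + 1 / (2 * c) \<partial>sample {1..n})"
    using int by (intro integral_mono) simp_all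
  also have "\<dots> = c / 2 * (1 / c\<^sup>2) + 1 / (2 * c)"
    using int sample_mean_second_moment[OF assms] by (simp add: c(2) prob_space)
  also have "\<dots> = 1 / c" using c(1) by (simp add: power2_eq_square)
  finally show ?thesis by (simp add: c_def)
qed

section \<open>The excess risk\<close>

lemma mean_fun_u: "mean_fun mu u = potential"
proof
  fix x
  show "mean_fun mu u x = potential x"
    using integrable_mu by (simp add: mean_fun_def u_eq_tilt tilt_def mean_mu)
qed

lemma min_value_potential: "min_value potential = - 1"
  unfolding min_value_def
  by (rule Least_equality) (use potential_pi[symmetric] potential_ge in auto)

lemma potential_measurable [measurable]: "potential \<in> borel_measurable borel"
  unfolding potential_eq[abs_def] penalty_def by measurable

lemma excess_risk_bound:
  assumes "1 \<le> n"
  shows "(\<integral>x. potential x \<partial>mixed_S0 mu u n) + 1 \<le> pi / 6 * (1 / sqrt (12 * real n))"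
proof -
  interpret prob_space "sample {1..n}" by (rule prob_space_sample)
  have AE: "AE z in sample {1..n}. potential (minimizer (sample_mean n z)) + 1 \<le> pi / 6 * \<bar>sample_mean n z\<bar>"
    using AE_sample_mean[OF assms]
  proof eventually_elim
    case (elim z)
    then obtain s where "s < pi / 6"
      "potential (minimizer (sample_mean n z)) + 1 \<le> \<bar>sample_mean n z\<bar> * s"
      by (auto elim: minimizer_cases)
    moreover have "\<bar>sample_mean n z\<bar> * s \<le> \<bar>sample_mean n z\<bar> * (pi / 6)"
      using \<open>s < pi / 6\<close> by (intro mult_left_mono) auto
    ultimately show ?case by (simp add: mult.commute)
  qed
  note int = integrable_sample_mean_power[of n 1, simplified]
  have "integrable (sample {1..n}) (\<lambda>z. potential (minimizer (sample_mean n z)) + 1)"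
  proof (rule Bochner_Integration.integrable_bound)
    show "integrable (sample {1..n}) (\<lambda>z. pi / 6 * \<bar>sample_mean n z\<bar>)" using int by simp
    show "AE z in sample {1..n}. norm (potential (minimizer (sample_mean n z)) + 1)
        \<le> norm (pi / 6 * \<bar>sample_mean n z\<bar>)"
      using AE
    proof eventually_elim
      case (elim z)
      then show ?case using potential_ge[of "minimizer (sample_mean n z)"] by simp
    qed
  qed (intro borel_measurable_add borel_measurable_const
      measurable_compose[OF minimizer_mean_measurable potential_measurable])
  note int' = this
  have "integrable (sample {1..n}) (\<lambda>z. potential (minimizer (sample_mean n z)))"
    using Bochner_Integration.integrable_diff[OF int' integrable_const[of 1]] by simp
  then have "(\<integral>z. potential (minimizer (sample_mean n z)) + 1 \<partial>sample {1..n})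
      = (\<integral>z. potential (minimizer (sample_mean n z)) \<partial>sample {1..n}) + 1"
    by (simp add: prob_space)
  moreover have "(\<integral>x. potential x \<partial>mixed_S0 mu u n)
      = (\<integral>z. potential (minimizer (sample_mean n z)) \<partial>sample {1..n})"
    unfolding mixed_S0_eq_distr[OF assms]
    by (rule integral_distr[OF minimizer_mean_measurable potential_measurable])
  ultimately have "(\<integral>x. potential x \<partial>mixed_S0 mu u n) + 1
      = (\<integral>z. potential (minimizer (sample_mean n z)) + 1 \<partial>sample {1..n})"
    by simp
  also have "\<dots> \<le> (\<integral>z. pi / 6 * \<bar>sample_mean n z\<bar> \<partial>sample {1..n})"
    using int' int AE by (intro integral_mono_AE) auto
  also have "\<dots> \<le> pi / 6 * (1 / sqrt (12 * real n))"
    using mult_left_mono[OF sample_mean_first_absolute_moment[OF assms], of "pi / 6"] by simp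
  finally show ?thesis .
qed

section \<open>Weak convergence\<close>

lemma prob_sample_mean_pos:
  assumes "1 \<le> n"
  shows "measure (sample {1..n}) {z \<in> space (sample {1..n}). 0 < sample_mean n z} = 1 / 2"
proof -
  interpret prob_space "sample {1..n}" by (rule prob_space_sample)
  let ?P = "{z \<in> space (sample {1..n}). 0 < sample_mean n z}"
  let ?N = "{z \<in> space (sample {1..n}). sample_mean n z < 0}"
  have "prob ?N = prob ?P"
  proof -
    have "0 < sample_mean n z \<longleftrightarrow> 0 < (\<Sum>i=1..n. z i)" "sample_mean n z < 0 \<longleftrightarrow> (\<Sum>i=1..n. z i) < 0" for z
      using assms by (simp_all add: sample_mean_def zero_less_divide_iff divide_less_0_iff)
    then show ?thesis using sample_sum_sign_symmetric[of "{1..n}"] by simp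
  qed
  moreover have "prob (?P \<union> ?N) = 1"
  proof (subst prob_eq_1)
    show "?P \<union> ?N \<in> events" by (intro sets.Un sets_mean_pos sets_mean_neg)
    show "AE z in sample {1..n}. z \<in> ?P \<union> ?N"
      using AE_sample_mean[OF assms] AE_space by eventually_elim auto
  qed
  moreover have "prob (?P \<union> ?N) = prob ?P + prob ?N"
    by (rule finite_measure_Union[OF sets_mean_pos sets_mean_neg]) auto
  ultimately show ?thesis by simp
qed

lemma prob_sample_mean_large:
  assumes "1 \<le> n" "0 < a"
  shows "measure (sample {1..n}) {z \<in> space (sample {1..n}). a \<le> \<bar>sample_mean n z\<bar>} \<le> 1 / (12 * real n) / a\<^sup>2"
proof -
  interpret prob_space "sample {1..n}" by (rule prob_space_sample)
  have "integrable (sample {1..n}) (\<lambda>z. (sample_mean n z)\<^sup>2)"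
    using integrable_sample_mean_power[of n 2] by simp
  from second_moment_method[OF sample_mean_measurable this \<open>0 < a\<close>] show ?thesis
    unfolding sample_mean_second_moment[OF assms(1)] .
qed

lemma emeasure_dirac_average:
  assumes A: "A \<in> sets borel"
  shows "emeasure (dirac_average a b) A = (indicator A a + indicator A b) / 2"
proof -
  let ?f = "\<lambda>A. (emeasure (return borel a) A + emeasure (return borel b) A) / 2"
  have "emeasure (dirac_average a b) A = ?f A"
  proof (rule emeasure_measure_of_sigma[of UNIV "sets borel" ?f, folded dirac_average_def])
    show "sigma_algebra UNIV (sets (borel :: real measure))"
      using sets.sigma_algebra_axioms[of "borel :: real measure"] by simp
    show "positive (sets borel) ?f" by (simp add: positive_def)
    show "countably_additive (sets borel) ?f"
      unfolding countably_additive_def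
    proof safe
      fix F :: "nat \<Rightarrow> real set"
      assume F: "range F \<subseteq> sets borel" "disjoint_family F"
      have "(\<Sum>i. emeasure (return borel c) (F i)) = emeasure (return borel c) (\<Union>i. F i)" for c
        using F by (intro suminf_emeasure) auto
      then show "(\<Sum>i. ?f (F i)) = ?f (\<Union>i. F i)"
        unfolding ennreal_suminf_divide suminf_add[OF summableI summableI, symmetric] by simp
    qed
  qed (rule A)
  with A show "emeasure (dirac_average a b) A = (indicator A a + indicator A b) / 2" by simp
qed

lemma cdf_dirac_average:
  "cdf (dirac_average (- pi) pi) x = (if x < - pi then 0 else if x < pi then 1 / 2 else 1)"
proof -
  have D: "emeasure (dirac_average (- pi) pi) {..x} = (indicator {..x} (- pi) + indicator {..x} pi) / 2"
    by (rule emeasure_dirac_average) simp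
  have "- pi < pi" by simp
  then consider "x < - pi" "x < pi" | "- pi \<le> x" "x < pi" | "- pi \<le> x" "pi \<le> x"
    by linarith
  then show ?thesis
  proof cases
    case 1
    with D show ?thesis by (simp add: cdf_def measure_def)
  next
    case 2
    with D have "emeasure (dirac_average (- pi) pi) {..x} = ennreal (1 / 2)"
      by (simp add: divide_ennreal[symmetric] divide_ennreal_def)
    then have "cdf (dirac_average (- pi) pi) x = 1 / 2"
      unfolding cdf_def measure_def by (simp only: enn2real_ennreal)
    with 2 show ?thesis by simp
  next
    case 3
    with D have "emeasure (dirac_average (- pi) pi) {..x} = 1" by simp
    with 3 show ?thesis by (simp add: cdf_def measure_def)
  qed
qed

text \<open>
  The distribution functions of \<open>\<mu>\<^sup>n S0\<close> are \<open>1 / 2\<close> on all of \<open>[- pi, pi]\<close>, so at \<open>pi\<close> they do not converge to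
  the limiting value \<open>1\<close>; this point is exempt because the limit jumps there. At \<open>- pi\<close> the limiting
  value \<open>1 / 2\<close> is attained.
\<close>

lemma not_isCont_cdf_dirac_average: "\<not> isCont (cdf (dirac_average (- pi) pi)) pi"
proof
  let ?F = "cdf (dirac_average (- pi) pi)"
  assume "isCont ?F pi"
  then have "(?F \<longlongrightarrow> 1) (at_left pi)"
    by (simp add: isCont_def cdf_dirac_average filterlim_at_split)
  moreover have "(?F \<longlongrightarrow> 1 / 2) (at_left pi)"
  proof (rule tendsto_eventually)
    show "\<forall>\<^sub>F x in at_left pi. ?F x = 1 / 2"
      by (rule eventually_at_leftI[of "- pi"]) (auto simp: cdf_dirac_average)
  qed
  ultimately show False
    using tendsto_unique[of "at_left pi" ?F 1 "1 / 2"] by simp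
qed

lemma cdf_mixed_S0:
  assumes "1 \<le> n"
  shows "cdf (mixed_S0 mu u n) x
    = measure (sample {1..n}) {z \<in> space (sample {1..n}). minimizer (sample_mean n z) \<le> x}"
proof -
  have "(\<lambda>z. minimizer (sample_mean n z)) -` {..x} \<inter> space (sample {1..n})
    = {z \<in> space (sample {1..n}). minimizer (sample_mean n z) \<le> x}" by auto
  then show ?thesis
    by (simp add: cdf_def mixed_S0_eq_distr[OF assms] measure_distr[OF minimizer_mean_measurable])
qed

text \<open>
  No mass falls strictly between the two sides, so on this range the distribution function counts
  exactly the samples with positive mean.
\<close>

lemma cdf_mixed_S0_middle:
  assumes "1 \<le> n" "- pi \<le> x" "x \<le> pi"
  shows "cdf (mixed_S0 mu u n) x = 1 / 2"
proof -
  interpret prob_space "sample {1..n}" by (rule prob_space_sample)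
  have "AE z in sample {1..n}. minimizer (sample_mean n z) \<le> x \<longleftrightarrow> 0 < sample_mean n z"
    using AE_sample_mean[OF assms(1)]
  proof eventually_elim
    case (elim z)
    then obtain s where "0 < s" "minimizer (sample_mean n z) = - sgn (sample_mean n z) * (pi + s)"
      by (auto elim: minimizer_cases)
    with elim assms(2,3) show ?case
      by (cases "0 < sample_mean n z") simp_all
  qed
  then have "cdf (mixed_S0 mu u n) x = prob {z \<in> space (sample {1..n}). 0 < sample_mean n z}"
    unfolding cdf_mixed_S0[OF assms(1)]
    by (intro measure_eq_AE sets_minimizer_le sets_mean_pos) auto
  then show ?thesis using prob_sample_mean_pos[OF assms(1)] by simp
qed

text \<open>
  To be \<open>d\<close> beyond \<open>\<plusminus> pi\<close> the minimiser needs a tilt of at least \<open>d ^ 3 / 2\<close>, which is unlikely by the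
  second moment method.
\<close>

lemma prob_minimizer_far:
  assumes "1 \<le> n" "0 < d"
  shows "measure (sample {1..n}) {z \<in> space (sample {1..n}). pi + d \<le> \<bar>minimizer (sample_mean n z)\<bar>}
    \<le> 1 / (12 * real n) / (d ^ 3 / 2)\<^sup>2"
proof -
  interpret prob_space "sample {1..n}" by (rule prob_space_sample)
  have "AE z in sample {1..n}. pi + d \<le> \<bar>minimizer (sample_mean n z)\<bar> \<longrightarrow> d ^ 3 / 2 \<le> \<bar>sample_mean n z\<bar>"
    using AE_sample_mean[OF assms(1)]
  proof eventually_elim
    case (elim z)
    then obtain s where s: "0 < s" "s ^ 3 \<le> 2 * \<bar>sample_mean n z\<bar>"
      "minimizer (sample_mean n z) = - sgn (sample_mean n z) * (pi + s)"
      by (auto elim: minimizer_cases)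
    then have "\<bar>minimizer (sample_mean n z)\<bar> = pi + s"
      using elim pi_gt_zero by (simp add: abs_mult abs_sgn_eq)
    moreover have "d ^ 3 / 2 \<le> \<bar>sample_mean n z\<bar>" if "d \<le> s"
      using s(2) power_mono[OF that, of 3] assms(2) by linarith
    ultimately show ?case by auto
  qed
  then have "prob {z \<in> space (sample {1..n}). pi + d \<le> \<bar>minimizer (sample_mean n z)\<bar>}
      \<le> prob {z \<in> space (sample {1..n}). d ^ 3 / 2 \<le> \<bar>sample_mean n z\<bar>}"
    by (intro finite_measure_mono_AE sets_mean_large) auto
  also have "\<dots> \<le> 1 / (12 * real n) / (d ^ 3 / 2)\<^sup>2"
    using assms by (intro prob_sample_mean_large) auto
  finally show ?thesis .
qed

lemma prob_minimizer_far_tendsto: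
  assumes "0 < d"
  shows "(\<lambda>n. measure (sample {1..n}) {z \<in> space (sample {1..n}). pi + d \<le> \<bar>minimizer (sample_mean n z)\<bar>})
    \<longlonglongrightarrow> 0"
proof (rule tendsto_sandwich[OF _ _ tendsto_const])
  show "(\<lambda>n. 1 / (12 * real n) / (d ^ 3 / 2)\<^sup>2) \<longlonglongrightarrow> 0"
  proof -
    have "(\<lambda>n. 1 / real n * (1 / 12 / (d ^ 3 / 2)\<^sup>2)) \<longlonglongrightarrow> 0 * (1 / 12 / (d ^ 3 / 2)\<^sup>2)"
      by (intro tendsto_mult lim_1_over_n tendsto_const)
    moreover have "1 / real n * (1 / 12 / (d ^ 3 / 2)\<^sup>2) = 1 / (12 * real n) / (d ^ 3 / 2)\<^sup>2" for n
      by simp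
    ultimately show ?thesis by (simp only: mult_zero_left)
  qed
  show "\<forall>\<^sub>F n in sequentially. measure (sample {1..n})
      {z \<in> space (sample {1..n}). pi + d \<le> \<bar>minimizer (sample_mean n z)\<bar>} \<le> 1 / (12 * real n) / (d ^ 3 / 2)\<^sup>2"
    using eventually_ge_at_top[of 1] by eventually_elim (rule prob_minimizer_far[OF _ assms])
qed simp

lemma weak_conv_mixed_S0: "weak_conv_m (\<lambda>n. mixed_S0 mu u n) (dirac_average (- pi) pi)"
  unfolding weak_conv_m_def weak_conv_def
proof safe
  fix x :: real
  let ?F = "cdf (dirac_average (- pi) pi)"
  assume "isCont ?F x"
  then have "x \<noteq> pi" using not_isCont_cdf_dirac_average by blast
  then consider "x < - pi" | "- pi \<le> x" "x < pi" | "pi < x" by linarith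
  then show "(\<lambda>n. cdf (mixed_S0 mu u n) x) \<longlonglongrightarrow> ?F x"
  proof cases
    case 1
    have le: "cdf (mixed_S0 mu u n) x \<le> measure (sample {1..n})
        {z \<in> space (sample {1..n}). pi + (- pi - x) \<le> \<bar>minimizer (sample_mean n z)\<bar>}" if "1 \<le> n" for n
    proof -
      interpret prob_space "sample {1..n}" by (rule prob_space_sample)
      show ?thesis
        unfolding cdf_mixed_S0[OF that] by (intro finite_measure_mono sets_minimizer_far sets_minimizer_le) auto
    qed
    have "(\<lambda>n. cdf (mixed_S0 mu u n) x) \<longlonglongrightarrow> 0"
    proof (rule tendsto_sandwich[OF _ _ tendsto_const])
      show "(\<lambda>n. measure (sample {1..n}) {z \<in> space (sample {1..n}). pi + (- pi - x) \<le> \<bar>minimizer (sample_mean n z)\<bar>})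
        \<longlonglongrightarrow> 0"
        using 1 by (intro prob_minimizer_far_tendsto) simp
      show "\<forall>\<^sub>F n in sequentially. cdf (mixed_S0 mu u n) x \<le> measure (sample {1..n})
        {z \<in> space (sample {1..n}). pi + (- pi - x) \<le> \<bar>minimizer (sample_mean n z)\<bar>}"
        using eventually_ge_at_top[of 1] by eventually_elim (rule le)
    qed (simp add: cdf_def)
    with 1 show ?thesis by (simp add: cdf_dirac_average)
  next
    case 2
    have "\<forall>\<^sub>F n in sequentially. cdf (mixed_S0 mu u n) x = 1 / 2"
      using eventually_ge_at_top[of 1]
      by eventually_elim (use 2 in \<open>simp add: cdf_mixed_S0_middle\<close>)
    with 2 show ?thesis by (simp add: cdf_dirac_average tendsto_eventually)
  next
    case 3
    let ?far = "\<lambda>n. measure (sample {1..n}) {z \<in> space (sample {1..n}). pi + (x - pi) \<le> \<bar>minimizer (sample_mean n z)\<bar>}"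
    have bounds: "1 - ?far n \<le> cdf (mixed_S0 mu u n) x" "cdf (mixed_S0 mu u n) x \<le> 1" if "1 \<le> n" for n
    proof -
      interpret prob_space "sample {1..n}" by (rule prob_space_sample)
      show "cdf (mixed_S0 mu u n) x \<le> 1"
        unfolding cdf_mixed_S0[OF that] by (rule prob_le_1)
      have "1 - ?far n = prob (space (sample {1..n})
          - {z \<in> space (sample {1..n}). pi + (x - pi) \<le> \<bar>minimizer (sample_mean n z)\<bar>})"
        by (intro prob_compl[symmetric] sets_minimizer_far)
      also have "\<dots> \<le> cdf (mixed_S0 mu u n) x"
        unfolding cdf_mixed_S0[OF that] by (intro finite_measure_mono sets_minimizer_far sets_minimizer_le) auto
      finally show "1 - ?far n \<le> cdf (mixed_S0 mu u n) x" .
    qed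
    have "(\<lambda>n. cdf (mixed_S0 mu u n) x) \<longlonglongrightarrow> 1"
    proof (rule tendsto_sandwich[OF _ _ _ tendsto_const])
      show "(\<lambda>n. 1 - ?far n) \<longlonglongrightarrow> 1"
        using tendsto_diff[OF tendsto_const prob_minimizer_far_tendsto[of "x - pi"], of 1] 3 by simp
      show "\<forall>\<^sub>F n in sequentially. 1 - ?far n \<le> cdf (mixed_S0 mu u n) x"
        using eventually_ge_at_top[of 1] by eventually_elim (rule bounds)
      show "\<forall>\<^sub>F n in sequentially. cdf (mixed_S0 mu u n) x \<le> 1"
        using eventually_ge_at_top[of 1] by eventually_elim (rule bounds)
    qed
    moreover have "?F x = 1" using 3 less_trans[of "- pi" pi x] by (simp add: cdf_dirac_average)
    ultimately show ?thesis by simp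
  qed
qed

theorem proposition10:
  "weak_conv_m (\<lambda>n. mixed_S0 mu u n) (dirac_average (- pi) pi) \<and>
   (\<forall>n\<ge>1. (\<integral>x. mean_fun mu u x \<partial>(mixed_S0 mu u n)) - min_value (mean_fun mu u)
             \<le> pi / (6 * sqrt 3) * real n powr (- 1 / 2))"
proof (intro conjI allI impI)
  show "weak_conv_m (\<lambda>n. mixed_S0 mu u n) (dirac_average (- pi) pi)"
    by (rule weak_conv_mixed_S0)
  fix n :: nat
  assume n: "1 \<le> n"
  have "sqrt (12 * real n) = 2 * sqrt 3 * sqrt n"
    using real_sqrt_mult[of 4 3] by (simp add: real_sqrt_mult)
  then have "pi / 6 * (1 / sqrt (12 * real n)) \<le> pi / (6 * sqrt 3) * (1 / sqrt n)"
    using n by (simp add: field_simps)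
  moreover have "real n powr (- 1 / 2) = 1 / sqrt n"
    using n by (simp add: powr_minus_divide powr_half_sqrt)
  ultimately show "(\<integral>x. mean_fun mu u x \<partial>mixed_S0 mu u n) - min_value (mean_fun mu u)
      \<le> pi / (6 * sqrt 3) * real n powr (- 1 / 2)"
    using excess_risk_bound[OF n] by (simp add: mean_fun_u min_value_potential)
qed

end
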